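(* Consider an imprecise probability tree. Let $\mathcal{M}$ be a submartingale such that $\Delta\mathcal{M}$ is uniformly bounded, i.e. there is a real $B$ with $|\Delta\mathcal{M}(x_{1:n})(x_{n+1})|\leq B$ for all $n\in\mathbb{N}_0$, $x_{1:n}\in\mathcal{X}_{1:n}$ and $x_{n+1}\in\mathcal{X}_{n+1}$, and let $\mathcal{S}$ be a real process that only assumes values in $\{0,1\}$. Then strictly almost surely $$\lim\mathcal{I}^{\mathcal{S}}=+\infty\ \Rightarrow\ \liminf\langle\mathcal{M}\rangle_{\mathcal{S}}\geq0.$$ That is, the set of paths $\omega\in\Omega$ for which $\lim_{n\to\infty}\mathcal{I}^{\mathcal{S}}(\omega^n)=+\infty$ and $\liminf_{n\to\infty}\langle\mathcal{M}\rangle_{\mathcal{S}}(\omega^n)<0$ is strictly null.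
   Context: Write $\mathbb{N}=\{1,2,\dots\}$ and $\mathbb{N}_0=\mathbb{N}\cup\{0\}$. For each $k\in\mathbb{N}$ let $\mathcal{X}_k$ be a non-empty finite set. A situation is a finite string $x_{1:n}=(x_1,\dots,x_n)\in\mathcal{X}_{1:n}:=\mathcal{X}_1\times\dots\times\mathcal{X}_n$ with $n\in\mathbb{N}_0$; the empty string ($n=0$) is denoted $\square$. A path is an element $\omega=(\omega_1,\omega_2,\dots)$ of $\Omega:=\prod_{k\in\mathbb{N}}\mathcal{X}_k$, and $\omega^n:=(\omega_1,\dots,\omega_n)$. An event is a subset of $\Omega$. A gamble on a set $Y$ is a bounded function $Y\to\mathbb{R}$; $\mathcal{G}(Y)$ is the set of all gambles on $Y$. A lower expectation on $\mathcal{G}(Y)$ is a functional $\underline{E}\colon\mathcal{G}(Y)\to\mathbb{R}$ with $\underline{E}(f)\geq\inf f$, $\underline{E}(f+g)\geq\underline{E}(f)+\underline{E}(g)$ and $\underline{E}(\lambda f)=\lambda\underline{E}(f)$ for all gambles $f,g$ and real $\lambda\geq0$; its conjugate upper expectation is $\overline{E}(f):=-\underline{E}(-f)$. An imprecise probability tree attaches to each situation $x_{1:n}$ a lower expectation $\underline{Q}(\cdot|x_{1:n})$ on $\mathcal{G}(\mathcal{X}_{n+1})$, with conjugate $\overline{Q}(\cdot|x_{1:n})$. A real process $\mathcal{F}$ is a real-valued map on the set of situations; its difference is given by $\Delta\mathcal{F}(x_{1:n})(x_{n+1}):=\mathcal{F}(x_{1:n+1})-\mathcal{F}(x_{1:n})$,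 so $\Delta\mathcal{F}(x_{1:n})\in\mathcal{G}(\mathcal{X}_{n+1})$. A submartingale is a real process $\mathcal{M}$ with $\underline{Q}(\Delta\mathcal{M}(x_{1:n})|x_{1:n})\geq0$ for all situations $x_{1:n}$; a supermartingale is a real process $\mathcal{M}$ such that $-\mathcal{M}$ is a submartingale, i.e. $\overline{Q}(\Delta\mathcal{M}(x_{1:n})|x_{1:n})\leq0$ for all situations. A test supermartingale is a supermartingale $\mathcal{T}$ with $\mathcal{T}(\square)=1$ and $\mathcal{T}(s)\geq0$ for all situations $s$. An event $A$ is strictly null if there is a test supermartingale $\mathcal{T}$ with $\lim_{n\to\infty}\mathcal{T}(\omega^n)=+\infty$ for all $\omega\in A$. A statement about paths holds strictly almost surely if the event that it fails is strictly null. For a real process $\mathcal{F}$, $\liminf\mathcal{F}(\omega):=\liminf_{n\to\infty}\mathcal{F}(\omega^n)$, and similarly for $\lim$. For a $\{0,1\}$-valued real process $\mathcal{S}$, $\mathcal{I}^{\mathcal{S}}(x_{1:n}):=\sum_{k=0}^{n-1}\mathcal{S}(x_{1:k})$, and the $\mathcal{S}$-averaged process of $\mathcal{F}$ is $\langle\mathcal{F}\rangle_{\mathcal{S}}(x_{1:n}):=0$ if $\mathcal{I}^{\mathcal{S}}(x_{1:n})=0$, and $\langle\mathcal{F}\rangle_{\mathcal{S}}(x_{1:n}):=\frac{\sum_{k=0}^{n-1}\mathcal{S}(x_{1:k})\,\Delta\mathcal{F}(x_{1:k})(x_{k+1})}{\mathcal{I}^{\mathcal{S}}(x_{1:n})}$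 if $\mathcal{I}^{\mathcal{S}}(x_{1:n})>0$. *)

theory Defs
  imports "HOL-Analysis.Analysis"
begin

(* A gamble on Y is represented by a function on the whole ambient type of which only
   the values on Y matter; lower_expectation_cong shows that a lower expectation on the
   gambles on Y indeed ignores the values outside Y. *)
definition gambles :: "'a set \<Rightarrow> ('a \<Rightarrow> real) set" where
  "gambles Y = {f. bounded (f ` Y)}"

definition lower_expectation :: "'a set \<Rightarrow> (('a \<Rightarrow> real) \<Rightarrow> real) \<Rightarrow> bool" where
  "lower_expectation Y E \<longleftrightarrow>
     (\<forall>f\<in>gambles Y. E f \<ge> (INF x\<in>Y. f x)) \<and>
     (\<forall>f\<in>gambles Y. \<forall>g\<in>gambles Y. E (\<lambda>x. f x + g x) \<ge> E f + E g) \<and>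
     (\<forall>f\<in>gambles Y. \<forall>c::real. c \<ge> 0 \<longrightarrow> E (\<lambda>x. c * f x) = c * E f)"

lemma lower_expectation_cong:
  assumes E: "lower_expectation Y E" and "Y \<noteq> {}"
    and f: "f \<in> gambles Y" and g: "g \<in> gambles Y" and eq: "\<And>x. x \<in> Y \<Longrightarrow> f x = g x"
  shows "E f = E g"
proof -
  have le: "E v \<le> E u"
    if "u \<in> gambles Y" "v \<in> gambles Y" "\<And>x. x \<in> Y \<Longrightarrow> u x = v x" for u v
  proof -
    have 0: "(\<lambda>x. u x - v x) ` Y = {0}" using that(3) \<open>Y \<noteq> {}\<close> by auto
    then have d: "(\<lambda>x. u x - v x) \<in> gambles Y" by (simp add: gambles_def)
    have "E (\<lambda>x. u x - v x) \<ge> (INF x\<in>Y. u x - v x)"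
      using E d unfolding lower_expectation_def by blast
    then have "E (\<lambda>x. u x - v x) \<ge> 0" using 0 by simp
    moreover have "E (\<lambda>x. v x + (u x - v x)) \<ge> E v + E (\<lambda>x. u x - v x)"
      using E d that(2) unfolding lower_expectation_def by blast
    ultimately show ?thesis by simp
  qed
  show ?thesis using le[OF f g eq] le[OF g f eq[symmetric]] by simp
qed

(* State spaces, situations and paths are indexed from 0: "X k" is the state space at
   time k + 1, and "X (length s)" is the set of possible next states in situation s. *)
definition situations :: "(nat \<Rightarrow> 'a set) \<Rightarrow> 'a list set" where
  "situations X = {s. \<forall>k<length s. s ! k \<in> X k}"

definition paths :: "(nat \<Rightarrow> 'a set) \<Rightarrow> (nat \<Rightarrow> 'a) set" where
  "paths X = Pi UNIV X"

definition path_prefix :: "(nat \<Rightarrow> 'a) \<Rightarrow> nat \<Rightarrow> 'a list" where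
  "path_prefix \<omega> n = map \<omega> [0..<n]"

definition imprecise_probability_tree ::
    "(nat \<Rightarrow> 'a set) \<Rightarrow> ('a list \<Rightarrow> ('a \<Rightarrow> real) \<Rightarrow> real) \<Rightarrow> bool" where
  "imprecise_probability_tree X Q \<longleftrightarrow>
     (\<forall>k. finite (X k) \<and> X k \<noteq> {}) \<and>
     (\<forall>s\<in>situations X. lower_expectation (X (length s)) (Q s))"

(* Real processes have type "'a list \<Rightarrow> real"; values outside "situations X" are never used. *)
definition process_diff :: "('a list \<Rightarrow> real) \<Rightarrow> 'a list \<Rightarrow> 'a \<Rightarrow> real" where
  "process_diff F s x = F (s @ [x]) - F s"

definition submartingale ::
    "(nat \<Rightarrow> 'a set) \<Rightarrow> ('a list \<Rightarrow> ('a \<Rightarrow> real) \<Rightarrow> real) \<Rightarrow> ('a list \<Rightarrow> real) \<Rightarrow> bool" where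
  "submartingale X Q M \<longleftrightarrow> (\<forall>s\<in>situations X. Q s (process_diff M s) \<ge> 0)"

definition supermartingale ::
    "(nat \<Rightarrow> 'a set) \<Rightarrow> ('a list \<Rightarrow> ('a \<Rightarrow> real) \<Rightarrow> real) \<Rightarrow> ('a list \<Rightarrow> real) \<Rightarrow> bool" where
  "supermartingale X Q M \<longleftrightarrow> submartingale X Q (\<lambda>s. - M s)"

definition test_supermartingale ::
    "(nat \<Rightarrow> 'a set) \<Rightarrow> ('a list \<Rightarrow> ('a \<Rightarrow> real) \<Rightarrow> real) \<Rightarrow> ('a list \<Rightarrow> real) \<Rightarrow> bool" where
  "test_supermartingale X Q T \<longleftrightarrow>
     supermartingale X Q T \<and> T [] = 1 \<and> (\<forall>s\<in>situations X. T s \<ge> 0)"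

definition strictly_null ::
    "(nat \<Rightarrow> 'a set) \<Rightarrow> ('a list \<Rightarrow> ('a \<Rightarrow> real) \<Rightarrow> real) \<Rightarrow> (nat \<Rightarrow> 'a) set \<Rightarrow> bool" where
  "strictly_null X Q A \<longleftrightarrow>
     A \<subseteq> paths X \<and>
     (\<exists>T. test_supermartingale X Q T \<and>
          (\<forall>\<omega>\<in>A. filterlim (\<lambda>n. T (path_prefix \<omega> n)) at_top sequentially))"

definition strictly_almost_surely ::
    "(nat \<Rightarrow> 'a set) \<Rightarrow> ('a list \<Rightarrow> ('a \<Rightarrow> real) \<Rightarrow> real) \<Rightarrow> ((nat \<Rightarrow> 'a) \<Rightarrow> bool) \<Rightarrow> bool" where
  "strictly_almost_surely X Q P \<longleftrightarrow> strictly_null X Q {\<omega> \<in> paths X. \<not> P \<omega>}"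

definition selection_count :: "('a list \<Rightarrow> real) \<Rightarrow> 'a list \<Rightarrow> real" where
  "selection_count S s = (\<Sum>k<length s. S (take k s))"

definition averaged_process ::
    "('a list \<Rightarrow> real) \<Rightarrow> ('a list \<Rightarrow> real) \<Rightarrow> 'a list \<Rightarrow> real" where
  "averaged_process S F s =
     (if selection_count S s > 0
      then (\<Sum>k<length s. S (take k s) * process_diff F (take k s) (s ! k)) / selection_count S s
      else 0)"

end

theory Submission
  imports Defs
begin

text \<open>
  The theorem is a strong law of large numbers for the increments of a submartingale that a
  selection process picks out, and it is proved by betting on the failure of the law.

  Let \<open>B \<ge> 1\<close> bound the increments of \<open>M\<close>. Staking a fixed fraction \<open>\<xi>\<close> of the current capital
  against each selected increment gives the capital \<open>\<Prod>k. 1 - \<xi> * S * \<Delta>M\<close>, which is a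
  nonnegative supermartingale as long as \<open>\<xi> * B \<le> 1 / 2\<close>. Since \<open>ln (1 + t) \<ge> t - 2 * t\<^sup>2\<close> for
  \<open>\<bar>t\<bar> \<le> 1 / 2\<close>, its logarithm is at least \<open>\<xi> * I * (- A - 2 * \<xi> * B\<^sup>2)\<close>, where \<open>I\<close> is the number
  of selected increments and \<open>A\<close> their average (\<open>ln_betting_capital_ge\<close>). Hence, if \<open>I\<close> tends to
  infinity while \<open>A < - \<epsilon>\<close> infinitely often, the capital is unbounded along the path for every
  \<open>\<xi>\<close> with \<open>2 * \<xi> * B\<^sup>2 < \<epsilon>\<close> (\<open>betting_capital_unbounded\<close>).

  Two things remain: the capital must converge to infinity rather than be merely unbounded, and
  one supermartingale must serve all \<open>\<epsilon>\<close> at once. Both are achieved by mixing countably many test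
  supermartingales with the weights \<open>1 / 2 ^ Suc i\<close>, which yields a test supermartingale again if
  they have a common bound at each time (\<open>test_supermartingale_mixture\<close>). For the first, mix the
  copies of the capital that are stopped upon reaching \<open>2 ^ Suc k\<close>: every copy that has been
  stopped contributes at least 1 forever, and on a path with unbounded capital all copies
  eventually stop (\<open>mixture_stopped_tendsto_infinity\<close>). For the second, mix over a sequence of
  stakes that tends to 0.
\<close>

section \<open>Lower expectations and situations\<close>

lemma finite_gambles: "finite Y \<Longrightarrow> f \<in> gambles Y"
  by (simp add: gambles_def finite_imp_bounded)

lemma lower_expectation_superadditive:
  assumes "lower_expectation Y E" "finite Y"
  shows "E (\<lambda>x. f x + g x) \<ge> E f + E g"
  using assms finite_gambles unfolding lower_expectation_def by blast

lemma lower_expectation_scale: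
  assumes "lower_expectation Y E" "finite Y" "c \<ge> 0"
  shows "E (\<lambda>x. c * f x) = c * E f"
  using assms finite_gambles unfolding lower_expectation_def by blast

lemma lower_expectation_ge:
  assumes "lower_expectation Y E" "finite Y" "Y \<noteq> {}" "\<And>x. x \<in> Y \<Longrightarrow> f x \<ge> c"
  shows "E f \<ge> c"
proof -
  have "(INF x\<in>Y. f x) \<ge> c"
    using assms(3,4) by (intro cINF_greatest)
  moreover have "E f \<ge> (INF x\<in>Y. f x)"
    using assms(1) finite_gambles[OF assms(2)] unfolding lower_expectation_def by blast
  ultimately show ?thesis by simp
qed

lemma lower_expectation_weighted_sum_nonneg:
  fixes n :: nat
  assumes E: "lower_expectation Y E" "finite Y" "Y \<noteq> {}"
    and w: "\<And>i. w i \<ge> 0" and f: "\<And>i. E (f i) \<ge> 0"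
  shows "E (\<lambda>x. \<Sum>i<n. w i * f i x) \<ge> 0"
proof (induction n)
  case 0
  show ?case using lower_expectation_ge[OF E, of 0 "\<lambda>x. 0"] by simp
next
  case (Suc n)
  have "E (\<lambda>x. w n * f n x) \<ge> 0"
    using lower_expectation_scale[OF E(1,2) w, of n "f n"] w[of n] f[of n] by simp
  then show ?case
    using Suc lower_expectation_superadditive[OF E(1,2),
        of "\<lambda>x. \<Sum>i<n. w i * f i x" "\<lambda>x. w n * f n x"] by simp
qed

lemma situations_take: "s \<in> situations X \<Longrightarrow> take n s \<in> situations X"
  by (simp add: situations_def)

lemma situations_snoc: "s \<in> situations X \<Longrightarrow> x \<in> X (length s) \<Longrightarrow> s @ [x] \<in> situations X"
  by (auto simp: situations_def nth_append less_Suc_eq)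

lemma path_prefix_situations: "\<omega> \<in> paths X \<Longrightarrow> path_prefix \<omega> n \<in> situations X"
  by (auto simp: situations_def path_prefix_def paths_def)

lemma length_path_prefix [simp]: "length (path_prefix \<omega> n) = n"
  by (simp add: path_prefix_def)

lemma take_path_prefix: "take m (path_prefix \<omega> n) = path_prefix \<omega> (min m n)"
  by (simp add: path_prefix_def take_map min_def)

lemma tree_lower_expectation:
  assumes "imprecise_probability_tree X Q" "s \<in> situations X"
  shows "lower_expectation (X (length s)) (Q s)" "finite (X (length s))" "X (length s) \<noteq> {}"
  using assms by (auto simp: imprecise_probability_tree_def)

lemma test_supermartingale_diff:
  assumes "test_supermartingale X Q T" "s \<in> situations X"
  shows "Q s (\<lambda>x. T s - T (s @ [x])) \<ge> 0"
proof -
  have "Q s (process_diff (\<lambda>s. - T s) s) \<ge> 0"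
    using assms
    by (auto simp: test_supermartingale_def supermartingale_def submartingale_def)
  moreover have "process_diff (\<lambda>s. - T s) s = (\<lambda>x. T s - T (s @ [x]))"
    by (auto simp: process_diff_def)
  ultimately show ?thesis by simp
qed

lemma test_supermartingaleI:
  assumes "T [] = 1" "\<And>s. s \<in> situations X \<Longrightarrow> T s \<ge> 0"
    and "\<And>s. s \<in> situations X \<Longrightarrow> Q s (\<lambda>x. T s - T (s @ [x])) \<ge> 0"
  shows "test_supermartingale X Q T"
proof -
  have "process_diff (\<lambda>s. - T s) s = (\<lambda>x. T s - T (s @ [x]))" for s
    by (auto simp: process_diff_def)
  then show ?thesis
    using assms by (auto simp: test_supermartingale_def supermartingale_def submartingale_def)
qed

section \<open>Countable mixtures of test supermartingales\<close>

text \<open>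
  The convex combination of a sequence of processes with weights \<open>1 / 2 ^ Suc i\<close>. It is
  meaningful where the values \<open>T i s\<close> are bounded in \<open>i\<close>, which makes the series summable.
\<close>

definition mixture :: "(nat \<Rightarrow> 'a list \<Rightarrow> real) \<Rightarrow> 'a list \<Rightarrow> real" where
  "mixture T s = (\<Sum>i. (1/2) ^ Suc i * T i s)"

lemma mixture_summable:
  assumes "\<And>i. 0 \<le> T i s" "\<And>i. T i s \<le> C"
  shows "summable (\<lambda>i. (1/2) ^ Suc i * T i s :: real)"
proof (rule summable_comparison_test')
  show "summable (\<lambda>i. (1/2) ^ Suc i * C :: real)"
    by (rule summable_mult2) (rule sums_summable[OF power_half_series])
  show "norm ((1/2) ^ Suc i * T i s) \<le> (1/2) ^ Suc i * C" if "i \<ge> 0" for i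
    using assms[of i] by (simp add: abs_mult)
qed

lemma mixture_ge_partial_sum:
  assumes "\<And>i. 0 \<le> T i s" "\<And>i. T i s \<le> C"
  shows "(\<Sum>i<n. (1/2) ^ Suc i * T i s) \<le> mixture T s"
  unfolding mixture_def using assms by (intro sum_le_suminf mixture_summable) auto

lemma mixture_nonneg:
  assumes "\<And>i. 0 \<le> T i s" "\<And>i. T i s \<le> C"
  shows "0 \<le> mixture T s"
  using mixture_ge_partial_sum[of T s C 0] assms by simp

lemma mixture_ge_term:
  assumes "\<And>i. 0 \<le> T i s" "\<And>i. T i s \<le> C"
  shows "(1/2) ^ Suc m * T m s \<le> mixture T s"
proof -
  have "(1/2) ^ Suc m * T m s \<le> (\<Sum>i<Suc m. (1/2) ^ Suc i * T i s)"
    using assms(1) by (intro member_le_sum[where f = "\<lambda>i. (1/2) ^ Suc i * T i s"]) auto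
  then show ?thesis using mixture_ge_partial_sum[of T s C "Suc m"] assms by simp
qed

lemma mixture_le_partial_sum:
  assumes "\<And>i. 0 \<le> T i s" "\<And>i. T i s \<le> C"
  shows "mixture T s \<le> (\<Sum>i<n. (1/2) ^ Suc i * T i s) + (1/2) ^ n * C"
proof -
  have sm: "summable (\<lambda>i. (1/2) ^ Suc i * T i s)" using mixture_summable assms by metis
  have s2: "(\<lambda>i. (1/2) ^ n * C * (1/2) ^ Suc i) sums ((1/2) ^ n * C * 1)"
    by (rule sums_mult) (rule power_half_series)
  have "mixture T s = (\<Sum>i. (1/2) ^ Suc (i + n) * T (i + n) s) + (\<Sum>i<n. (1/2) ^ Suc i * T i s)"
    unfolding mixture_def by (rule suminf_split_initial_segment[OF sm])
  moreover have "(\<Sum>i. (1/2) ^ Suc (i + n) * T (i + n) s) \<le> (\<Sum>i. (1/2) ^ n * C * (1/2) ^ Suc i)"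
  proof (rule suminf_le)
    show "summable (\<lambda>i. (1/2) ^ Suc (i + n) * T (i + n) s)"
      using summable_ignore_initial_segment[OF sm] by simp
    show "summable (\<lambda>i. (1/2) ^ n * C * (1/2) ^ Suc i)" by (rule sums_summable[OF s2])
    show "(1/2) ^ Suc (i + n) * T (i + n) s \<le> (1/2) ^ n * C * (1/2) ^ Suc i" for i
      using assms(2)[of "i + n"] by (simp add: power_add)
  qed
  ultimately show ?thesis using sums_unique[OF s2] by simp
qed

lemma mixture_le:
  assumes "\<And>i. 0 \<le> T i s" "\<And>i. T i s \<le> C"
  shows "mixture T s \<le> C"
  using mixture_le_partial_sum[of T s C 0] assms by simp

text \<open>
  A lower expectation is only finitely superadditive, so the mixture is compared with its partial
  sums; the common bound at each time makes the remainder uniformly small.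
\<close>

lemma test_supermartingale_mixture:
  assumes tree: "imprecise_probability_tree X Q"
    and T: "\<And>i. test_supermartingale X Q (T i)"
    and le: "\<And>i s. s \<in> situations X \<Longrightarrow> T i s \<le> C (length s)"
  shows "test_supermartingale X Q (mixture T)"
proof (rule test_supermartingaleI)
  have nn: "0 \<le> T i s" if "s \<in> situations X" for i s
    using T that by (auto simp: test_supermartingale_def)
  have "T i [] = 1" for i using T by (auto simp: test_supermartingale_def)
  then show "mixture T [] = 1"
    using sums_unique[OF power_half_series] by (simp add: mixture_def)
  show "mixture T s \<ge> 0" if "s \<in> situations X" for s
    using mixture_nonneg[of T s "C (length s)"] nn le that by blast
  fix s assume s: "s \<in> situations X"
  note E = tree_lower_expectation[OF tree s]
  define D where "D = C (Suc (length s))"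
  define R where "R n x = mixture T s - mixture T (s @ [x])
    - (\<Sum>i<n. (1/2) ^ Suc i * (T i s - T i (s @ [x])))" for n x
  have R: "R n x \<ge> - ((1/2) ^ n * D)" if x: "x \<in> X (length s)" for n x
  proof -
    have "mixture T (s @ [x]) \<le> (\<Sum>i<n. (1/2) ^ Suc i * T i (s @ [x])) + (1/2) ^ n * D"
      using mixture_le_partial_sum[of T "s @ [x]" D n] nn le situations_snoc[OF s x]
      unfolding D_def by (metis length_append_singleton)
    moreover have "mixture T s \<ge> (\<Sum>i<n. (1/2) ^ Suc i * T i s)"
      using mixture_ge_partial_sum[of T s "C (length s)" n] nn le s by blast
    ultimately show ?thesis
      unfolding R_def right_diff_distrib sum_subtractf by simp
  qed
  have "Q s (\<lambda>x. mixture T s - mixture T (s @ [x])) \<ge> - ((1/2) ^ n * D)" for n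
  proof -
    have "Q s (\<lambda>x. \<Sum>i<n. (1/2) ^ Suc i * (T i s - T i (s @ [x]))) \<ge> 0"
      using lower_expectation_weighted_sum_nonneg[OF E, of "\<lambda>i. (1/2) ^ Suc i"]
        test_supermartingale_diff[OF T s] by simp
    moreover have "Q s (R n) \<ge> - ((1/2) ^ n * D)"
      using lower_expectation_ge[OF E] R by blast
    moreover have "(\<lambda>x. mixture T s - mixture T (s @ [x])) =
        (\<lambda>x. (\<Sum>i<n. (1/2) ^ Suc i * (T i s - T i (s @ [x]))) + R n x)"
      by (auto simp: R_def)
    ultimately show ?thesis
      using lower_expectation_superadditive[OF E(1,2),
          of "\<lambda>x. \<Sum>i<n. (1/2) ^ Suc i * (T i s - T i (s @ [x]))" "R n"] by simp
  qed
  moreover have "(\<lambda>n. - ((1/2) ^ n * D)) \<longlonglongrightarrow> - (0 * D)"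
    by (intro tendsto_intros LIMSEQ_power_zero) auto
  ultimately show "Q s (\<lambda>x. mixture T s - mixture T (s @ [x])) \<ge> 0"
    by (intro LIMSEQ_le_const2[where X = "\<lambda>n. - ((1/2) ^ n * D)"]) auto
qed

section \<open>Stopping a test supermartingale\<close>

text \<open>
  The process \<open>F\<close> frozen from the first time at which it reaches the level \<open>c\<close>. The alternative
  \<open>length s \<le> j\<close> makes the least index exist, and gives \<open>F s\<close> if the level has not been reached.
\<close>

definition stopped :: "('a list \<Rightarrow> real) \<Rightarrow> real \<Rightarrow> 'a list \<Rightarrow> real" where
  "stopped F c s = F (take (LEAST j. length s \<le> j \<or> c \<le> F (take j s)) s)"

lemma stopped_eq:
  assumes "\<And>j. j < length s \<Longrightarrow> F (take j s) < c"
  shows "stopped F c s = F s"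
proof -
  have "(LEAST j. length s \<le> j \<or> c \<le> F (take j s)) = length s"
    by (rule Least_equality) (use assms in \<open>auto simp: not_le[symmetric]\<close>)
  then show ?thesis by (simp add: stopped_def)
qed

lemma stopped_reached:
  assumes "j \<le> length s" "c \<le> F (take j s)"
  shows "c \<le> stopped F c s"
proof -
  let ?P = "\<lambda>j. length s \<le> j \<or> c \<le> F (take j s)"
  have "?P (Least ?P)" by (rule LeastI[of ?P j]) (use assms in auto)
  moreover have "Least ?P \<le> j" by (rule Least_le) (use assms in auto)
  ultimately show ?thesis
    using assms by (auto simp: stopped_def)
qed

lemma stopped_snoc_frozen:
  assumes "j \<le> length s" "c \<le> F (take j s)"
  shows "stopped F c (s @ [x]) = stopped F c s"
proof -
  let ?P = "\<lambda>j. length s \<le> j \<or> c \<le> F (take j s)"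
  let ?P' = "\<lambda>j. length (s @ [x]) \<le> j \<or> c \<le> F (take j (s @ [x]))"
  have 1: "?P (Least ?P)" by (rule LeastI[of ?P j]) (use assms in auto)
  have 2: "Least ?P \<le> j" by (rule Least_le) (use assms in auto)
  have 3: "c \<le> F (take (Least ?P) s)"
    using 1 2 assms by (metis le_antisym le_trans)
  have "Least ?P' = Least ?P"
  proof (rule Least_equality)
    show "?P' (Least ?P)" using 2 3 assms by auto
    show "Least ?P \<le> y" if "?P' y" for y
    proof (cases "y \<le> length s")
      case True
      then show ?thesis using that by (intro Least_le) auto
    qed (use 2 assms in auto)
  qed
  then show ?thesis using 2 assms by (simp add: stopped_def)
qed

lemma stopped_snoc_running:
  assumes "\<And>j. j \<le> length s \<Longrightarrow> F (take j s) < c"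
  shows "stopped F c (s @ [x]) = F (s @ [x])"
  by (rule stopped_eq) (use assms in auto)

lemma stopped_le:
  assumes "s \<in> situations X" "\<And>s. s \<in> situations X \<Longrightarrow> F s \<le> C (length s)"
    and "mono C"
  shows "stopped F c s \<le> C (length s)"
proof -
  let ?t = "take (LEAST j. length s \<le> j \<or> c \<le> F (take j s)) s"
  have "F ?t \<le> C (length ?t)" using assms situations_take by blast
  also have "\<dots> \<le> C (length s)" by (rule monoD[OF \<open>mono C\<close>]) simp
  finally show ?thesis by (simp add: stopped_def)
qed

lemma test_supermartingale_stopped:
  assumes tree: "imprecise_probability_tree X Q" and F: "test_supermartingale X Q F"
  shows "test_supermartingale X Q (stopped F c)"
proof (rule test_supermartingaleI)
  show "stopped F c [] = 1" using F by (simp add: stopped_def test_supermartingale_def)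
  show "stopped F c s \<ge> 0" if "s \<in> situations X" for s
    using F situations_take[OF that] by (simp add: stopped_def test_supermartingale_def)
  fix s assume s: "s \<in> situations X"
  note E = tree_lower_expectation[OF tree s]
  show "Q s (\<lambda>x. stopped F c s - stopped F c (s @ [x])) \<ge> 0"
  proof (cases "\<exists>j\<le>length s. c \<le> F (take j s)")
    case True
    then obtain j where "j \<le> length s" "c \<le> F (take j s)" by blast
    then have "stopped F c s - stopped F c (s @ [x]) = 0" for x
      using stopped_snoc_frozen[of j s c F x] by simp
    then show ?thesis using lower_expectation_ge[OF E, of 0 "\<lambda>x. 0"] by simp
  next
    case False
    then have "\<And>j. j \<le> length s \<Longrightarrow> F (take j s) < c" by force
    then have "(\<lambda>x. stopped F c s - stopped F c (s @ [x])) = (\<lambda>x. F s - F (s @ [x]))"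
      by (simp add: stopped_eq stopped_snoc_running)
    then show ?thesis using test_supermartingale_diff[OF F s] by simp
  qed
qed

text \<open>
  Mixing the stopped copies turns unboundedness along a path into convergence to infinity: the
  weight \<open>1 / 2 ^ Suc k\<close> exactly cancels the level \<open>2 ^ Suc k\<close> at which the copy is frozen.
\<close>

lemma mixture_stopped_tendsto_infinity:
  assumes F: "\<And>s. s \<in> situations X \<Longrightarrow> 0 \<le> F s" "\<And>s. s \<in> situations X \<Longrightarrow> F s \<le> C (length s)"
    and C: "mono C" and \<omega>: "\<omega> \<in> paths X"
    and unb: "\<And>c. \<exists>n. F (path_prefix \<omega> n) \<ge> c"
  shows "filterlim (\<lambda>n. mixture (\<lambda>k. stopped F (2 ^ Suc k)) (path_prefix \<omega> n)) at_top sequentially"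
  unfolding filterlim_at_top
proof
  fix Z :: real
  obtain K :: nat where K: "Z \<le> real K" using real_arch_simple by blast
  have "eventually (\<lambda>n. 2 ^ Suc k \<le> stopped F (2 ^ Suc k) (path_prefix \<omega> n)) sequentially" for k
  proof -
    obtain N where N: "F (path_prefix \<omega> N) \<ge> 2 ^ Suc k" using unb by blast
    have "2 ^ Suc k \<le> stopped F (2 ^ Suc k) (path_prefix \<omega> n)" if "n \<ge> N" for n
      by (rule stopped_reached[of N]) (use that N in \<open>auto simp: take_path_prefix min_def\<close>)
    then show ?thesis by (auto simp: eventually_sequentially)
  qed
  then have "eventually (\<lambda>n. \<forall>k\<in>{..<K}.
      2 ^ Suc k \<le> stopped F (2 ^ Suc k) (path_prefix \<omega> n)) sequentially"
    by (intro eventually_ball_finite) auto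
  then show "eventually (\<lambda>n. Z \<le> mixture (\<lambda>k. stopped F (2 ^ Suc k)) (path_prefix \<omega> n)) sequentially"
  proof eventually_elim
    case (elim n)
    let ?s = "path_prefix \<omega> n"
    have s: "?s \<in> situations X" using \<omega> by (rule path_prefix_situations)
    have "real K = (\<Sum>k<K. (1/2) ^ Suc k * 2 ^ Suc k :: real)"
      by (simp flip: power_mult_distrib power_Suc)
    also have "\<dots> \<le> (\<Sum>k<K. (1/2) ^ Suc k * stopped F (2 ^ Suc k) ?s)"
      using elim by (intro sum_mono mult_left_mono) auto
    also have "\<dots> \<le> mixture (\<lambda>k. stopped F (2 ^ Suc k)) ?s"
      by (rule mixture_ge_partial_sum[where C = "C (length ?s)"])
         (use F(1) situations_take[OF s] stopped_le[OF s F(2) C] in \<open>auto simp: stopped_def\<close>)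
    finally show ?case using K by simp
  qed
qed

section \<open>The betting capital\<close>

text \<open>
  The capital, starting from 1, of a gambler who at each selected situation stakes the fraction
  \<open>\<xi>\<close> of the current capital against the increment of \<open>M\<close>.
\<close>

definition betting_capital ::
    "real \<Rightarrow> ('a list \<Rightarrow> real) \<Rightarrow> ('a list \<Rightarrow> real) \<Rightarrow> 'a list \<Rightarrow> real" where
  "betting_capital \<xi> S M s =
     (\<Prod>k<length s. 1 - \<xi> * (S (take k s) * process_diff M (take k s) (s ! k)))"

lemma betting_capital_snoc:
  "betting_capital \<xi> S M (s @ [x]) =
     betting_capital \<xi> S M s * (1 - \<xi> * (S s * process_diff M s x))"
  by (simp add: betting_capital_def nth_append)

lemma situations_nth: "s \<in> situations X \<Longrightarrow> k < length s \<Longrightarrow> s ! k \<in> X (length (take k s))"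
  by (simp add: situations_def)

lemma selected_increment_bound:
  assumes M: "\<forall>s\<in>situations X. \<forall>x\<in>X (length s). \<bar>process_diff M s x\<bar> \<le> B"
    and S: "\<forall>s\<in>situations X. S s \<in> {0, 1}"
    and \<xi>: "0 \<le> \<xi>" "\<xi> * B \<le> 1/2" and B: "0 \<le> B"
    and s: "s \<in> situations X" "x \<in> X (length s)"
  shows "\<bar>\<xi> * (S s * process_diff M s x)\<bar> \<le> 1/2"
proof -
  have "\<bar>S s * process_diff M s x\<bar> \<le> B" using M S s B by force
  then have "\<xi> * \<bar>S s * process_diff M s x\<bar> \<le> \<xi> * B" using \<xi> by (intro mult_left_mono)
  then show ?thesis using \<xi> by (simp add: abs_mult)
qed

lemma betting_capital_bounds:
  assumes M: "\<forall>s\<in>situations X. \<forall>x\<in>X (length s). \<bar>process_diff M s x\<bar> \<le> B"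
    and S: "\<forall>s\<in>situations X. S s \<in> {0, 1}"
    and \<xi>: "0 \<le> \<xi>" "\<xi> * B \<le> 1/2" and B: "0 \<le> B"
    and s: "s \<in> situations X"
  shows "0 < betting_capital \<xi> S M s" "betting_capital \<xi> S M s \<le> 2 ^ length s"
proof -
  have *: "\<bar>\<xi> * (S (take k s) * process_diff M (take k s) (s ! k))\<bar> \<le> 1/2" if "k < length s" for k
    by (rule selected_increment_bound[OF M S \<xi> B situations_take[OF s] situations_nth[OF s that]])
  show "0 < betting_capital \<xi> S M s"
    unfolding betting_capital_def using * by (intro prod_pos) force
  have "betting_capital \<xi> S M s \<le> (\<Prod>k<length s. 2)"
    unfolding betting_capital_def using * by (intro prod_mono) force
  then show "betting_capital \<xi> S M s \<le> 2 ^ length s" by simp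
qed

lemma test_supermartingale_betting_capital:
  assumes tree: "imprecise_probability_tree X Q" and sub: "submartingale X Q M"
    and M: "\<forall>s\<in>situations X. \<forall>x\<in>X (length s). \<bar>process_diff M s x\<bar> \<le> B"
    and S: "\<forall>s\<in>situations X. S s \<in> {0, 1}"
    and \<xi>: "0 \<le> \<xi>" "\<xi> * B \<le> 1/2" and B: "0 \<le> B"
  shows "test_supermartingale X Q (betting_capital \<xi> S M)"
proof (rule test_supermartingaleI)
  show "betting_capital \<xi> S M [] = 1" by (simp add: betting_capital_def)
  show "betting_capital \<xi> S M s \<ge> 0" if "s \<in> situations X" for s
    using betting_capital_bounds(1)[OF M S \<xi> B that] by simp
  fix s assume s: "s \<in> situations X"
  define c where "c = betting_capital \<xi> S M s * \<xi> * S s"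
  have c: "c \<ge> 0"
    using betting_capital_bounds(1)[OF M S \<xi> B s] \<xi> S s unfolding c_def by force
  have "(\<lambda>x. betting_capital \<xi> S M s - betting_capital \<xi> S M (s @ [x])) =
      (\<lambda>x. c * process_diff M s x)"
    by (auto simp: betting_capital_snoc c_def algebra_simps)
  moreover have "Q s (\<lambda>x. c * process_diff M s x) = c * Q s (process_diff M s)"
    by (rule lower_expectation_scale[OF tree_lower_expectation(1,2)[OF tree s] c])
  moreover have "Q s (process_diff M s) \<ge> 0"
    using sub s by (auto simp: submartingale_def)
  ultimately show "Q s (\<lambda>x. betting_capital \<xi> S M s - betting_capital \<xi> S M (s @ [x])) \<ge> 0"
    using c by simp
qed

lemma ln_betting_capital_ge:
  assumes M: "\<forall>s\<in>situations X. \<forall>x\<in>X (length s). \<bar>process_diff M s x\<bar> \<le> B"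
    and S: "\<forall>s\<in>situations X. S s \<in> {0, 1}"
    and \<xi>: "0 \<le> \<xi>" "\<xi> * B \<le> 1/2" and B: "0 \<le> B"
    and s: "s \<in> situations X" and pos: "selection_count S s > 0"
  shows "ln (betting_capital \<xi> S M s) \<ge>
           \<xi> * (- averaged_process S M s - 2 * \<xi> * B\<^sup>2) * selection_count S s"
proof -
  define d where "d k = S (take k s) * process_diff M (take k s) (s ! k)" for k
  have half: "\<bar>\<xi> * d k\<bar> \<le> 1/2" if "k < length s" for k
    unfolding d_def
    by (rule selected_increment_bound[OF M S \<xi> B situations_take[OF s] situations_nth[OF s that]])
  have sq: "(d k)\<^sup>2 \<le> B\<^sup>2 * S (take k s)" if k: "k < length s" for k
  proof -
    have "\<bar>process_diff M (take k s) (s ! k)\<bar> \<le> B"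
      using M situations_take[OF s] situations_nth[OF s k] by blast
    then have "(process_diff M (take k s) (s ! k))\<^sup>2 \<le> B\<^sup>2"
      using power_mono[of "\<bar>process_diff M (take k s) (s ! k)\<bar>" B 2] by simp
    then show ?thesis
      using S situations_take[OF s, of k] unfolding d_def by force
  qed
  have ln_term: "ln (1 - \<xi> * d k) \<ge> - \<xi> * d k - 2 * \<xi>\<^sup>2 * B\<^sup>2 * S (take k s)"
    if k: "k < length s" for k
  proof -
    have "\<bar>ln (1 + - (\<xi> * d k)) - - (\<xi> * d k)\<bar> \<le> 2 * (- (\<xi> * d k))\<^sup>2"
      by (rule abs_ln_one_plus_x_minus_x_bound) (use half[OF k] in simp)
    moreover have "(\<xi> * d k)\<^sup>2 \<le> \<xi>\<^sup>2 * (B\<^sup>2 * S (take k s))"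
      unfolding power_mult_distrib using sq[OF k] by (intro mult_left_mono) auto
    ultimately show ?thesis by (simp add: abs_le_iff)
  qed
  have "ln (betting_capital \<xi> S M s) = (\<Sum>k<length s. ln (1 - \<xi> * d k))"
    unfolding betting_capital_def d_def[symmetric]
    by (rule ln_prod) (use half in force)+
  also have "\<dots> \<ge> (\<Sum>k<length s. - \<xi> * d k - 2 * \<xi>\<^sup>2 * B\<^sup>2 * S (take k s))"
    using ln_term by (intro sum_mono) auto
  also have "(\<Sum>k<length s. - \<xi> * d k - 2 * \<xi>\<^sup>2 * B\<^sup>2 * S (take k s)) =
      - \<xi> * (\<Sum>k<length s. d k) - 2 * \<xi>\<^sup>2 * B\<^sup>2 * selection_count S s"
    by (simp add: sum_subtractf sum_distrib_left selection_count_def sum_negf)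
  also have "(\<Sum>k<length s. d k) = averaged_process S M s * selection_count S s"
    using pos by (simp add: averaged_process_def d_def)
  finally show ?thesis by (simp add: algebra_simps power2_eq_square)
qed

lemma betting_capital_unbounded:
  assumes M: "\<forall>s\<in>situations X. \<forall>x\<in>X (length s). \<bar>process_diff M s x\<bar> \<le> B"
    and S: "\<forall>s\<in>situations X. S s \<in> {0, 1}"
    and \<xi>: "0 < \<xi>" "\<xi> * B \<le> 1/2" and B: "0 \<le> B" and \<epsilon>: "2 * \<xi> * B\<^sup>2 < \<epsilon>"
    and \<omega>: "\<omega> \<in> paths X"
    and count: "filterlim (\<lambda>n. selection_count S (path_prefix \<omega> n)) at_top sequentially"
    and freq: "frequently (\<lambda>n. averaged_process S M (path_prefix \<omega> n) < - \<epsilon>) sequentially"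
  shows "\<exists>n. betting_capital \<xi> S M (path_prefix \<omega> n) \<ge> c"
proof -
  define r where "r = \<xi> * (\<epsilon> - 2 * \<xi> * B\<^sup>2)"
  have r: "r > 0" using \<xi> \<epsilon> by (simp add: r_def)
  have "eventually (\<lambda>n. selection_count S (path_prefix \<omega> n) \<ge> max 1 (c / r)) sequentially"
    using count unfolding filterlim_at_top by blast
  then obtain n where n: "averaged_process S M (path_prefix \<omega> n) < - \<epsilon>"
      "selection_count S (path_prefix \<omega> n) \<ge> max 1 (c / r)"
    using frequently_ex[OF frequently_eventually_conj[OF freq]] by blast
  let ?s = "path_prefix \<omega> n"
  have s: "?s \<in> situations X" using \<omega> by (rule path_prefix_situations)
  have "c \<le> r * selection_count S ?s" using n(2) r by (simp add: field_simps)
  also have "\<dots> \<le> \<xi> * (- averaged_process S M ?s - 2 * \<xi> * B\<^sup>2) * selection_count S ?s"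
    unfolding r_def using n \<xi> by (intro mult_right_mono mult_left_mono) auto
  also have "\<dots> \<le> ln (betting_capital \<xi> S M ?s)"
    using n \<xi> by (intro ln_betting_capital_ge[OF M S _ _ B s]) auto
  also have "\<dots> \<le> betting_capital \<xi> S M ?s"
    using ln_less_self[OF betting_capital_bounds(1)[OF M S _ \<xi>(2) B s]] \<xi> by simp
  finally show ?thesis by blast
qed

section \<open>The law of large numbers\<close>

theorem theorem7:
  fixes X :: "nat \<Rightarrow> 'a set"
    and Q :: "'a list \<Rightarrow> ('a \<Rightarrow> real) \<Rightarrow> real"
    and M S :: "'a list \<Rightarrow> real"
  assumes "imprecise_probability_tree X Q"
    and "submartingale X Q M"
    and "\<exists>B. \<forall>s\<in>situations X. \<forall>x\<in>X (length s). \<bar>process_diff M s x\<bar> \<le> B"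
    and "\<forall>s\<in>situations X. S s \<in> {0, 1}"
  shows "strictly_almost_surely X Q (\<lambda>\<omega>.
           filterlim (\<lambda>n. selection_count S (path_prefix \<omega> n)) at_top sequentially \<longrightarrow>
           liminf (\<lambda>n. ereal (averaged_process S M (path_prefix \<omega> n))) \<ge> 0)"
proof -
  note tree = assms(1) and S = assms(4)
  obtain B0 where B0: "\<forall>s\<in>situations X. \<forall>x\<in>X (length s). \<bar>process_diff M s x\<bar> \<le> B0"
    using assms(3) by blast
  define B where "B = max 1 B0"
  have B: "1 \<le> B" and M: "\<forall>s\<in>situations X. \<forall>x\<in>X (length s). \<bar>process_diff M s x\<bar> \<le> B"
    using B0 by (auto simp: B_def intro: le_max_iff_disj[THEN iffD2])
  \<comment> \<open>The stakes are chosen such that \<open>2 * \<xi> m * B\<^sup>2 = 1 / (m + 1)\<close>, which is eventually below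
    any given \<open>\<epsilon>\<close>; the choice \<open>B \<ge> 1\<close> then also gives \<open>\<xi> m * B \<le> 1 / 2\<close>.\<close>
  define \<xi> where "\<xi> m = 1 / (2 * B\<^sup>2 * (real m + 1))" for m
  have \<xi>_pos: "0 < \<xi> m" for m using B by (auto simp: \<xi>_def)
  have \<xi>_sq: "2 * \<xi> m * B\<^sup>2 = 1 / (real m + 1)" for m using B by (simp add: \<xi>_def)
  have \<xi>_half: "\<xi> m * B \<le> 1/2" for m
  proof -
    have "2 * (\<xi> m * B) \<le> 2 * (\<xi> m * B\<^sup>2)"
      using B \<xi>_pos[of m] self_le_power[of B 2] by simp
    also have "\<dots> = 1 / (real m + 1)" using \<xi>_sq[of m] by simp
    also have "\<dots> \<le> 1" by simp
    finally show ?thesis by simp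
  qed
  define F where "F m = betting_capital (\<xi> m) S M" for m
  define T where "T m = mixture (\<lambda>k. stopped (F m) (2 ^ Suc k))" for m
  define C :: "nat \<Rightarrow> real" where "C n = 2 ^ n" for n
  have C: "mono C" by (auto simp: C_def mono_def)
  have F_test: "test_supermartingale X Q (F m)" for m
    unfolding F_def
    using test_supermartingale_betting_capital[OF tree assms(2) M S _ \<xi>_half] \<xi>_pos[of m] B by simp
  have F_nonneg: "0 \<le> F m s" if "s \<in> situations X" for m s
    using F_test that by (auto simp: test_supermartingale_def)
  have F_le: "F m s \<le> C (length s)" if "s \<in> situations X" for m s
    unfolding F_def C_def
    using betting_capital_bounds(2)[OF M S _ \<xi>_half _ that] \<xi>_pos[of m] B by simp
  have st_nonneg: "0 \<le> stopped (F m) c s" if "s \<in> situations X" for m c s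
    using F_nonneg situations_take[OF that] by (simp add: stopped_def)
  have st_le: "stopped (F m) c s \<le> C (length s)" if "s \<in> situations X" for m c s
    by (rule stopped_le[OF that F_le C])
  have T_test: "test_supermartingale X Q (T m)" for m
    unfolding T_def
    by (rule test_supermartingale_mixture[OF tree test_supermartingale_stopped[OF tree F_test] st_le])
  have T_nonneg: "0 \<le> T m s" and T_le: "T m s \<le> C (length s)" if s: "s \<in> situations X" for m s
    unfolding T_def
    using s by (auto intro!: mixture_nonneg mixture_le st_nonneg intro: st_le)
  have test: "test_supermartingale X Q (mixture T)"
    by (rule test_supermartingale_mixture[OF tree T_test T_le])
  have "filterlim (\<lambda>n. mixture T (path_prefix \<omega> n)) at_top sequentially"
    if \<omega>: "\<omega> \<in> paths X"
      and count: "filterlim (\<lambda>n. selection_count S (path_prefix \<omega> n)) at_top sequentially"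
      and neg: "\<not> liminf (\<lambda>n. ereal (averaged_process S M (path_prefix \<omega> n))) \<ge> 0" for \<omega>
  proof -
    from neg obtain y where y: "y < 0"
        "frequently (\<lambda>n. ereal (averaged_process S M (path_prefix \<omega> n)) \<le> y) sequentially"
      by (auto simp: le_Liminf_iff not_eventually not_less)
    obtain z where z: "y < ereal z" "ereal z < 0" using ereal_dense2[OF y(1)] by blast
    define \<epsilon> where "\<epsilon> = - z"
    have "\<epsilon> > 0" using z(2) by (simp add: \<epsilon>_def)
    have freq: "frequently (\<lambda>n. averaged_process S M (path_prefix \<omega> n) < - \<epsilon>) sequentially"
      using y(2)
    proof (rule frequently_elim1)
      show "averaged_process S M (path_prefix \<omega> n) < - \<epsilon>"
        if "ereal (averaged_process S M (path_prefix \<omega> n)) \<le> y" for n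
        using le_less_trans[OF that z(1)] by (simp add: \<epsilon>_def)
    qed
    obtain m where "1 / (real m + 1) < \<epsilon>"
      using reals_Archimedean[OF \<open>\<epsilon> > 0\<close>] by (auto simp: inverse_eq_divide add.commute)
    then have m: "2 * \<xi> m * B\<^sup>2 < \<epsilon>" by (simp add: \<xi>_sq)
    have "\<exists>n. F m (path_prefix \<omega> n) \<ge> c" for c
      unfolding F_def
      using betting_capital_unbounded[OF M S \<xi>_pos \<xi>_half _ m \<omega> count freq] B by simp
    then have "filterlim (\<lambda>n. T m (path_prefix \<omega> n)) at_top sequentially"
      unfolding T_def
      by (intro mixture_stopped_tendsto_infinity[OF F_nonneg F_le C \<omega>])
    then have "filterlim (\<lambda>n. (1/2) ^ Suc m * T m (path_prefix \<omega> n)) at_top sequentially"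
      by (intro filterlim_tendsto_pos_mult_at_top[OF tendsto_const]) auto
    then show ?thesis
    proof (rule filterlim_at_top_mono)
      have "(1/2) ^ Suc m * T m (path_prefix \<omega> n) \<le> mixture T (path_prefix \<omega> n)" for n
        using mixture_ge_term[of T "path_prefix \<omega> n"] T_nonneg T_le path_prefix_situations[OF \<omega>] by blast
      then show "eventually (\<lambda>n. (1/2) ^ Suc m * T m (path_prefix \<omega> n)
          \<le> mixture T (path_prefix \<omega> n)) sequentially" by simp
    qed
  qed
  then show ?thesis
    using test unfolding strictly_almost_surely_def strictly_null_def by blast
qed

end
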